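(* Let $p,q$ be distinct primes. In the cozero-divisor graph $\Gamma'(\mathbb{Z}_{p^2q}[x]/(x^2))$, for index pairs $(i_1,j_1),(i_2,j_2)\in\{1,\dots,p+4\}\times\{1,2,3\}$ different from $(1,1)$ and $(p+4,3)$, every vertex in $\mathcal{A}_{i_1,j_1}$ is adjacent to every vertex in $\mathcal{A}_{i_2,j_2}$ if and only if, possibly after interchanging the two index pairs, at least one of the following conditions holds: (1) $i_1\neq i_2$ and $i_1,i_2\in\{3,4,\dots,p+3\}$; (2) $i_1<i_2$ and $j_1>j_2$. Moreover, vertices from the same set $\mathcal{A}_{i,j}$ are never adjacent to each other.
   Context: For a commutative ring $R$ with nonzero identity, the cozero-divisor graph $\Gamma'(R)$ is the simple undirected graph whose vertices are the nonzero non-unit elements of $R$, with two distinct vertices $u,v$ adjacent if and only if $u\notin Rv$ and $v\notin Ru$. $\mathbb{Z}_n$ denotes the ring of integers modulo $n$. By the Chinese remainder theorem, $\mathbb{Z}_{p^2q}[x]/(x^2)\cong \mathbb{Z}_{p^2}[x]/(x^2)\times \mathbb{Z}_q[x]/(x^2)$; for $f\in\mathbb{Z}_{p^2q}[x]/(x^2)$ let $f_{p^2},f_q$ denote its images in the two factors. The principal ideals of $\mathbb{Z}_{p^2}[x]/(x^2)$ are labelled $I_1=\langle 0\rangle$, $I_2=\langle px\rangle$, $I_3=\langle x\rangle$, $I_4=\langle p\rangle$, $I_{l+4}=\langle x+lp\rangle$ for $l=1,\dots,p-1$, and $I_{p+4}=\mathbb{Z}_{p^2}[x]/(x^2)$ (generated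 by any unit). The principal ideals of $\mathbb{Z}_q[x]/(x^2)$ are labelled $J_1=\langle 0\rangle$, $J_2=\langle x\rangle$, $J_3=\mathbb{Z}_q[x]/(x^2)$. Define \[ \mathcal{A}_{i,j}=\{f\in\mathbb{Z}_{p^2q}[x]/(x^2): \langle f_{p^2}\rangle=I_i,\ \langle f_q\rangle=J_j\}. \] The sets $\mathcal{A}_{1,1}$ (the zero element) and $\mathcal{A}_{p+4,3}$ (the units) are omitted. *)

theory Defs
  imports "HOL-Algebra.UnivPoly" "HOL-Algebra.QuotRing" "HOL-Number_Theory.Residues"
begin

section \<open>Cozero-divisor graph\<close>

definition cozero_verts :: "('a, 'm) ring_scheme \<Rightarrow> 'a set" where
  "cozero_verts R = {u \<in> carrier R. u \<noteq> \<zero>\<^bsub>R\<^esub> \<and> u \<notin> Units R}"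

definition cozero_adj :: "('a, 'm) ring_scheme \<Rightarrow> 'a \<Rightarrow> 'a \<Rightarrow> bool" where
  "cozero_adj R u v \<longleftrightarrow>
     u \<in> cozero_verts R \<and> v \<in> cozero_verts R \<and> u \<noteq> v \<and>
     u \<notin> PIdl\<^bsub>R\<^esub> v \<and> v \<notin> PIdl\<^bsub>R\<^esub> u"

section \<open>The rings \<open>\<int>\<^sub>n[x]/(x\<^sup>2)\<close>\<close>

definition zpoly :: "nat \<Rightarrow> (int, nat \<Rightarrow> int) up_ring" where
  "zpoly n = UP (residue_ring (int n))"

definition xsq :: "nat \<Rightarrow> (nat \<Rightarrow> int) set" where
  "xsq n = PIdl\<^bsub>zpoly n\<^esub> (monom (zpoly n) \<one>\<^bsub>residue_ring (int n)\<^esub> 2)"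

definition zdual :: "nat \<Rightarrow> (nat \<Rightarrow> int) set ring" where
  "zdual n = zpoly n Quot xsq n"

text \<open>
  The class of \<open>a + b x\<close>.  The coefficients are reduced modulo \<open>n\<close> because
  \<^const>\<open>residue_ring\<close> has the carrier \<open>{0..n-1}\<close> and
  \<^const>\<open>monom\<close> is only specified on the carrier.
\<close>

definition lin :: "nat \<Rightarrow> int \<Rightarrow> int \<Rightarrow> (nat \<Rightarrow> int) set" where
  "lin n a b =
     xsq n +>\<^bsub>zpoly n\<^esub>
       (monom (zpoly n) (a mod int n) 0 \<oplus>\<^bsub>zpoly n\<^esub> monom (zpoly n) (b mod int n) 1)"

text \<open>
  For \<open>m\<close> dividing \<open>n\<close>, the canonical map
  \<open>\<int>\<^sub>n[x]/(x\<^sup>2) \<rightarrow> \<int>\<^sub>m[x]/(x\<^sup>2)\<close> reduces the coefficients of a representative modulo \<open>m\<close>.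
  The image below is a singleton because the resulting class does not depend on the
  representative.  For \<open>n = p\<^sup>2 q\<close> and \<open>m = p\<^sup>2\<close> or \<open>m = q\<close> these maps are the components
  of the Chinese remainder isomorphism.
\<close>

definition reduce :: "nat \<Rightarrow> nat \<Rightarrow> (nat \<Rightarrow> int) set \<Rightarrow> (nat \<Rightarrow> int) set" where
  "reduce n m F =
     the_elem ((\<lambda>f. xsq m +>\<^bsub>zpoly m\<^esub> (\<lambda>k. coeff (zpoly n) f k mod int m)) ` F)"

section \<open>The labelled ideals and the sets \<open>\<A>\<^sub>i\<^sub>,\<^sub>j\<close>\<close>

text \<open>
  Labels run from \<open>1\<close>.  For \<open>5 \<le> i \<le> p + 3\<close> the generator is \<open>x + l p\<close> with \<open>l = i - 4\<close>.
  The labels \<open>i = p + 4\<close> and \<open>j = 3\<close> stand for the whole ring; other labels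
  outside the range are irrelevant.
\<close>

definition I_ideal :: "nat \<Rightarrow> nat \<Rightarrow> (nat \<Rightarrow> int) set set" where
  "I_ideal p i =
     (let R = zdual (p^2) in
      if i = 1 then PIdl\<^bsub>R\<^esub> \<zero>\<^bsub>R\<^esub>
      else if i = 2 then PIdl\<^bsub>R\<^esub> (lin (p^2) 0 (int p))
      else if i = 3 then PIdl\<^bsub>R\<^esub> (lin (p^2) 0 1)
      else if i = 4 then PIdl\<^bsub>R\<^esub> (lin (p^2) (int p) 0)
      else if i \<le> p + 3 then PIdl\<^bsub>R\<^esub> (lin (p^2) (int (i - 4) * int p) 1)
      else carrier R)"

definition J_ideal :: "nat \<Rightarrow> nat \<Rightarrow> (nat \<Rightarrow> int) set set" where
  "J_ideal q j =
     (let R = zdual q in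
      if j = 1 then PIdl\<^bsub>R\<^esub> \<zero>\<^bsub>R\<^esub>
      else if j = 2 then PIdl\<^bsub>R\<^esub> (lin q 0 1)
      else carrier R)"

definition A_set :: "nat \<Rightarrow> nat \<Rightarrow> nat \<Rightarrow> nat \<Rightarrow> (nat \<Rightarrow> int) set set" where
  "A_set p q i j =
     {F \<in> carrier (zdual (p^2 * q)).
        PIdl\<^bsub>zdual (p^2)\<^esub> (reduce (p^2 * q) (p^2) F) = I_ideal p i \<and>
        PIdl\<^bsub>zdual q\<^esub> (reduce (p^2 * q) q F) = J_ideal q j}"

definition A_indices :: "nat \<Rightarrow> (nat \<times> nat) set" where
  "A_indices p = ({1..p + 4} \<times> {1..3}) - {(1, 1), (p + 4, 3)}"

end

theory Submission
  imports Defs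
begin

text \<open>
  For \<open>u\<close> and \<open>v\<close> in a commutative ring, \<open>u \<in> Rv\<close> says \<open>\<langle>u\<rangle> \<subseteq> \<langle>v\<rangle>\<close>, and for a product of two rings this
  inclusion is checked in each factor.  Hence \<open>u \<in> \<A>\<^sub>i\<^sub>,\<^sub>j\<close> is a multiple of \<open>v \<in> \<A>\<^sub>k\<^sub>,\<^sub>l\<close> iff
  \<open>I\<^sub>i \<subseteq> I\<^sub>k\<close> and \<open>J\<^sub>j \<subseteq> J\<^sub>l\<close>.  The ideals \<open>J\<close> form a chain; the ideals \<open>I\<close> form the chain
  \<open>I\<^sub>1, I\<^sub>2, *, I\<^sub>p\<^sub>+\<^sub>4\<close> in which the place \<open>*\<close> is taken by the antichain \<open>I\<^sub>3, \<dots>, I\<^sub>p\<^sub>+\<^sub>3\<close>.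
  Both facts are congruences between the coefficients of \<open>a + b x\<close>.
\<close>

section \<open>Arithmetic of \<open>a + b x\<close>\<close>

text \<open>The element \<open>a + b x\<close> is the multiple of \<open>c + d x\<close> by \<open>s + t x\<close>, modulo \<open>n\<close> and \<open>x\<^sup>2\<close>.\<close>

definition dual_dvd :: "nat \<Rightarrow> int \<Rightarrow> int \<Rightarrow> int \<Rightarrow> int \<Rightarrow> bool" where
  "dual_dvd n c d a b \<longleftrightarrow>
     (\<exists>s t. [a = s * c] (mod int n) \<and> [b = s * d + t * c] (mod int n))"

section \<open>The ring Z_n[x]/(x^2) for a fixed modulus n > 1\<close>

locale dual_residues =
  fixes n :: nat
  assumes n_gt_1: "1 < n"
begin

sublocale residues "int n" "residue_ring (int n)"
  by unfold_locales (use n_gt_1 in simp)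

sublocale P: UP_cring "residue_ring (int n)" "zpoly n"
  by unfold_locales (simp add: zpoly_def)

sublocale I: ideal "xsq n" "zpoly n"
  unfolding xsq_def by (intro P.P.cgenideal_ideal P.monom_closed one_closed)

sublocale Q: cring "zdual n"
  unfolding zdual_def by (intro I.quotient_is_cring P.P.is_cring)

lemma coeff_zpoly: "f \<in> carrier (zpoly n) \<Longrightarrow> coeff (zpoly n) f k = f k"
  by (simp add: zpoly_def UP_def)

lemma mod_in_residue_ring: "a mod int n \<in> carrier (residue_ring (int n))"
  using n_gt_1 by (simp add: res_carrier_eq)

lemma coeff_mod: "f \<in> carrier (zpoly n) \<Longrightarrow> coeff (zpoly n) f k mod int n = coeff (zpoly n) f k"
  using P.coeff_closed[of f k] by (simp add: res_carrier_eq)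

text \<open>A multiple of x^2 has no terms of degree 0 or 1; conversely, dropping two vanishing
  coefficients shifts the polynomial down to its quotient by x^2.\<close>

lemma mem_xsq_iff:
  "f \<in> xsq n \<longleftrightarrow>
    f \<in> carrier (zpoly n) \<and> coeff (zpoly n) f 0 = 0 \<and> coeff (zpoly n) f 1 = 0"
  (is "_ \<longleftrightarrow> ?rhs")
proof
  assume "f \<in> xsq n"
  then obtain h where h: "h \<in> carrier (zpoly n)"
    and f: "f = h \<otimes>\<^bsub>zpoly n\<^esub> monom (zpoly n) \<one>\<^bsub>residue_ring (int n)\<^esub> 2"
    unfolding xsq_def cgenideal_def by blast
  have "coeff (zpoly n) f k = 0" if "k < 2" for k
  proof -
    have "coeff (zpoly n) f k = finsum (residue_ring (int n))
        (\<lambda>i. coeff (zpoly n) h i \<otimes>\<^bsub>residue_ring (int n)\<^esub>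
          coeff (zpoly n) (monom (zpoly n) \<one>\<^bsub>residue_ring (int n)\<^esub> 2) (k - i)) {..k}"
      unfolding f using h by (intro P.coeff_mult) auto
    also have "\<dots> = finsum (residue_ring (int n)) (\<lambda>i. \<zero>\<^bsub>residue_ring (int n)\<^esub>) {..k}"
      using h that by (intro finsum_cong') auto
    also have "\<dots> = \<zero>\<^bsub>residue_ring (int n)\<^esub>" by simp
    finally have "coeff (zpoly n) f k = \<zero>\<^bsub>residue_ring (int n)\<^esub>" .
    then show ?thesis by (simp add: res_zero_eq)
  qed
  moreover have "f \<in> carrier (zpoly n)" using h by (simp add: f)
  ultimately show ?rhs by simp
next
  assume rhs: ?rhs
  \<comment> \<open>The quotient of \<open>f\<close> by x^2, with the same degree bound as
    \<open>f\<close>.\<close>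
  define h where "h = (\<lambda>k. f (k + 2))"
  have f: "f \<in> up (residue_ring (int n))" using rhs by (simp add: zpoly_def UP_def)
  have "h \<in> up (residue_ring (int n))"
  proof
    show "h k \<in> carrier (residue_ring (int n))" for k
      using f by (auto simp: h_def)
    obtain N where "bound \<zero>\<^bsub>residue_ring (int n)\<^esub> N f"
      using bound_upD[OF f] by blast
    then have "bound \<zero>\<^bsub>residue_ring (int n)\<^esub> N h"
      by (auto simp: bound_def h_def)
    then show "\<exists>N. bound \<zero>\<^bsub>residue_ring (int n)\<^esub> N h" ..
  qed
  then have h: "h \<in> carrier (zpoly n)" by (simp add: zpoly_def UP_def)
  have "f = h \<otimes>\<^bsub>zpoly n\<^esub> monom (zpoly n) \<one>\<^bsub>residue_ring (int n)\<^esub> 2"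
  proof (rule P.up_eqI)
    fix k
    let ?t = "\<lambda>i. coeff (zpoly n) h i \<otimes>\<^bsub>residue_ring (int n)\<^esub>
      coeff (zpoly n) (monom (zpoly n) \<one>\<^bsub>residue_ring (int n)\<^esub> 2) (k - i)"
    have "finsum (residue_ring (int n)) ?t {..k} = coeff (zpoly n) f k"
    proof (cases "k < 2")
      case True
      then have "finsum (residue_ring (int n)) ?t {..k} =
          finsum (residue_ring (int n)) (\<lambda>i. \<zero>\<^bsub>residue_ring (int n)\<^esub>) {..k}"
        using h by (intro finsum_cong') auto
      also have "\<dots> = 0" by (simp flip: res_zero_eq)
      finally show ?thesis using rhs True by (auto simp: less_2_cases_iff)
    next
      case False
      \<comment> \<open>Since k is at least 2, the monomial contributes only where k - i = 2, that
        is, at i = k - 2.\<close>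
      then have "finsum (residue_ring (int n)) ?t {..k} = finsum (residue_ring (int n))
          (\<lambda>i. if k - 2 = i then coeff (zpoly n) h i else \<zero>\<^bsub>residue_ring (int n)\<^esub>) {..k}"
        using h by (intro finsum_cong') auto
      also have "\<dots> = coeff (zpoly n) h (k - 2)"
        using h by (intro finsum_singleton) auto
      also have "\<dots> = coeff (zpoly n) f k"
        using coeff_zpoly[OF h] coeff_zpoly[of f] rhs le_add_diff_inverse2[of 2 k] False
        by (simp add: h_def)
      finally show ?thesis .
    qed
    then show "coeff (zpoly n) f k =
      coeff (zpoly n) (h \<otimes>\<^bsub>zpoly n\<^esub> monom (zpoly n) \<one>\<^bsub>residue_ring (int n)\<^esub> 2) k"
      using h by simp
  qed (use rhs h in auto)
  then show "f \<in> xsq n" using h unfolding xsq_def cgenideal_def by blast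
qed

lemma coset_eq_iff:
  assumes "f \<in> carrier (zpoly n)" "g \<in> carrier (zpoly n)"
  shows "xsq n +>\<^bsub>zpoly n\<^esub> f = xsq n +>\<^bsub>zpoly n\<^esub> g \<longleftrightarrow>
    coeff (zpoly n) f 0 = coeff (zpoly n) g 0 \<and> coeff (zpoly n) f 1 = coeff (zpoly n) g 1"
proof -
  have *: "coeff (zpoly n) (f \<ominus>\<^bsub>zpoly n\<^esub> g) k = 0 \<longleftrightarrow> coeff (zpoly n) f k = coeff (zpoly n) g k" for k
  proof -
    have "coeff (zpoly n) (f \<ominus>\<^bsub>zpoly n\<^esub> g) k =
        coeff (zpoly n) f k \<ominus>\<^bsub>residue_ring (int n)\<^esub> coeff (zpoly n) g k"
      using assms by (simp add: P.P.minus_eq minus_eq)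
    then show ?thesis
      using r_right_minus_eq[OF P.coeff_closed P.coeff_closed] assms by (simp add: res_zero_eq)
  qed
  have "xsq n +>\<^bsub>zpoly n\<^esub> f = xsq n +>\<^bsub>zpoly n\<^esub> g \<longleftrightarrow> f \<ominus>\<^bsub>zpoly n\<^esub> g \<in> xsq n"
    using P.P.quotient_eq_iff_same_a_r_cos[OF I.is_ideal] assms by blast
  then show ?thesis
    unfolding mem_xsq_iff * using assms by simp
qed

section \<open>Classes in the normal form a + b x and their arithmetic\<close>

definition rep :: "int \<Rightarrow> int \<Rightarrow> nat \<Rightarrow> int" where
  "rep a b = monom (zpoly n) (a mod int n) 0 \<oplus>\<^bsub>zpoly n\<^esub> monom (zpoly n) (b mod int n) 1"

lemma lin_rep: "lin n a b = xsq n +>\<^bsub>zpoly n\<^esub> rep a b"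
  by (simp add: lin_def rep_def)

lemma rep_closed [simp]: "rep a b \<in> carrier (zpoly n)"
  by (simp add: rep_def mod_in_residue_ring)

lemma coeff_rep: "coeff (zpoly n) (rep a b) 0 = a mod int n"
  "coeff (zpoly n) (rep a b) (Suc 0) = b mod int n"
  using mod_in_residue_ring by (simp_all add: rep_def r_zero l_zero)

lemma coset_eq_lin:
  assumes "f \<in> carrier (zpoly n)"
  shows "xsq n +>\<^bsub>zpoly n\<^esub> f = lin n (coeff (zpoly n) f 0) (coeff (zpoly n) f 1)"
  using assms by (simp add: lin_rep coset_eq_iff coeff_rep coeff_mod)

lemma carrier_zdual: "carrier (zdual n) = (\<lambda>f. xsq n +>\<^bsub>zpoly n\<^esub> f) ` carrier (zpoly n)"
  by (auto simp: zdual_def FactRing_simps)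

lemma lin_closed [simp]: "lin n a b \<in> carrier (zdual n)"
  by (simp add: carrier_zdual lin_rep)

lemma zdual_cases:
  assumes "F \<in> carrier (zdual n)"
  obtains a b where "F = lin n a b"
  using assms coset_eq_lin by (auto simp: carrier_zdual)

lemma lin_eq_iff: "lin n a b = lin n c d \<longleftrightarrow> [a = c] (mod int n) \<and> [b = d] (mod int n)"
  by (simp add: lin_rep coset_eq_iff coeff_rep cong_def)

text \<open>Multiply the representatives; the class keeps only the coefficients in degrees 0 and 1,
  so the term b d x^2 disappears.\<close>

lemma lin_mult: "lin n a b \<otimes>\<^bsub>zdual n\<^esub> lin n c d = lin n (a * c) (a * d + b * c)"
proof -
  have c: "coeff (zpoly n) (rep a b \<otimes>\<^bsub>zpoly n\<^esub> rep c d) 0 = (a * c) mod int n"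
    "coeff (zpoly n) (rep a b \<otimes>\<^bsub>zpoly n\<^esub> rep c d) 1 = (a * d + b * c) mod int n"
    using mod_in_residue_ring
    by (simp_all add: coeff_rep res_mult_eq res_add_eq mod_simps)
      (simp_all add: res_zero_eq add.commute)
  have "lin n a b \<otimes>\<^bsub>zdual n\<^esub> lin n c d = xsq n +>\<^bsub>zpoly n\<^esub> (rep a b \<otimes>\<^bsub>zpoly n\<^esub> rep c d)"
    unfolding lin_rep by (simp add: zdual_def FactRing_def I.rcoset_mult_add)
  then show ?thesis
    unfolding coset_eq_lin[OF P.P.m_closed[OF rep_closed rep_closed]] c by (simp add: lin_eq_iff)
qed

lemma zero_zdual: "\<zero>\<^bsub>zdual n\<^esub> = lin n 0 0"
proof -
  have "\<zero>\<^bsub>zdual n\<^esub> = xsq n +>\<^bsub>zpoly n\<^esub> \<zero>\<^bsub>zpoly n\<^esub>"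
    by (simp add: zdual_def FactRing_def I.a_rcos_const)
  then show ?thesis by (simp add: coset_eq_lin res_zero_eq)
qed

lemma one_zdual: "\<one>\<^bsub>zdual n\<^esub> = lin n 1 0"
proof -
  have "\<one>\<^bsub>zdual n\<^esub> = xsq n +>\<^bsub>zpoly n\<^esub> \<one>\<^bsub>zpoly n\<^esub>"
    by (simp add: zdual_def FactRing_def)
  then show ?thesis by (simp add: coset_eq_lin res_zero_eq res_one_eq)
qed

section \<open>Principal ideals, and reduction to a divisor of the modulus\<close>

lemma PIdl_subset_iff:
  assumes "F \<in> carrier (zdual n)" "G \<in> carrier (zdual n)"
  shows "PIdl\<^bsub>zdual n\<^esub> F \<subseteq> PIdl\<^bsub>zdual n\<^esub> G \<longleftrightarrow> F \<in> PIdl\<^bsub>zdual n\<^esub> G"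
  using assms Q.cgenideal_self Q.cgenideal_minimal Q.cgenideal_ideal by blast

text \<open>Every multiplier has the form s + t x, so comparing coefficients after
  \<open>lin_mult\<close> gives the two congruences of \<open>dual_dvd\<close>.\<close>

lemma lin_mem_PIdl_iff: "lin n a b \<in> PIdl\<^bsub>zdual n\<^esub> lin n c d \<longleftrightarrow> dual_dvd n c d a b"
proof -
  have "lin n a b \<in> PIdl\<^bsub>zdual n\<^esub> lin n c d \<longleftrightarrow>
      (\<exists>s t. lin n a b = lin n s t \<otimes>\<^bsub>zdual n\<^esub> lin n c d)"
  proof
    assume "lin n a b \<in> PIdl\<^bsub>zdual n\<^esub> lin n c d"
    then obtain x where "x \<in> carrier (zdual n)" "lin n a b = x \<otimes>\<^bsub>zdual n\<^esub> lin n c d"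
      by (auto simp: cgenideal_def)
    then show "\<exists>s t. lin n a b = lin n s t \<otimes>\<^bsub>zdual n\<^esub> lin n c d"
      by (elim zdual_cases) blast
  qed (auto simp: cgenideal_def)
  then show ?thesis by (simp add: lin_mult lin_eq_iff dual_dvd_def)
qed

end

text \<open>All representatives of a class agree modulo n in degrees 0 and 1, hence modulo its
  divisor m. Their reductions therefore form a single class, which makes \<open>the_elem\<close> in
  \<open>reduce\<close> meaningful.\<close>

lemma reduce_lin:
  assumes "1 < m" "1 < n" "m dvd n"
  shows "reduce n m (lin n a b) = lin m a b"
proof -
  interpret n: dual_residues n by unfold_locales fact
  interpret m: dual_residues m by unfold_locales fact
  have "xsq m +>\<^bsub>zpoly m\<^esub> (\<lambda>k. coeff (zpoly n) f k mod int m) = lin m a b" if f: "f \<in> lin n a b" for f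
  proof -
    have fc: "f \<in> carrier (zpoly n)"
      using f n.P.P.a_r_coset_subset_G[OF n.I.a_subset n.rep_closed] by (auto simp: n.lin_rep)
    have "xsq n +>\<^bsub>zpoly n\<^esub> f = lin n a b"
      using f n.I.a_repr_independence' fc n.rep_closed n.lin_rep by metis
    then have c: "[coeff (zpoly n) f 0 = a] (mod int n)" "[coeff (zpoly n) f 1 = b] (mod int n)"
      using fc by (simp_all add: n.coset_eq_lin n.lin_eq_iff)
    let ?g = "\<lambda>k. coeff (zpoly n) f k mod int m"
    have "f \<in> up (residue_ring (int n))" using fc by (simp add: zpoly_def UP_def)
    then obtain N where "bound \<zero>\<^bsub>residue_ring (int n)\<^esub> N f" using n.bound_upD by blast
    then have "bound \<zero>\<^bsub>residue_ring (int m)\<^esub> N ?g"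
      using fc by (auto simp: bound_def n.coeff_zpoly n.res_zero_eq m.res_zero_eq)
    then have "?g \<in> up (residue_ring (int m))"
      using m.mod_in_residue_ring by (intro mem_upI) auto
    then have g: "?g \<in> carrier (zpoly m)" by (simp add: zpoly_def UP_def)
    have "[?g 0 = a] (mod int m)" "[?g 1 = b] (mod int m)"
      using c \<open>m dvd n\<close> by (auto simp: cong_def intro: cong_dvd_modulus[unfolded cong_def])
    then show ?thesis
      using g by (simp add: m.coset_eq_lin m.coeff_zpoly m.lin_eq_iff)
  qed
  \<comment> \<open>Makes the image a singleton rather than the empty set.\<close>
  moreover have "lin n a b \<noteq> {}"
    using n.I.a_rcos_self n.rep_closed n.lin_rep by (metis empty_iff)
  ultimately have "(\<lambda>f. xsq m +>\<^bsub>zpoly m\<^esub> (\<lambda>k. coeff (zpoly n) f k mod int m)) ` lin n a b = {lin m a b}"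
    by auto
  then show ?thesis by (simp add: reduce_def)
qed

section \<open>The Chinese remainder theorem for principal ideals\<close>

text \<open>A multiplier modulo m k also works modulo m and modulo k; conversely, multipliers for
  the two factors are glued coefficient by coefficient with the Chinese remainder theorem.\<close>

lemma dual_dvd_mult_iff:
  assumes "coprime m k"
  shows "dual_dvd (m * k) c d a b \<longleftrightarrow> dual_dvd m c d a b \<and> dual_dvd k c d a b"
proof
  assume "dual_dvd (m * k) c d a b"
  then obtain s t where "[a = s * c] (mod int (m * k))" "[b = s * d + t * c] (mod int (m * k))"
    by (auto simp: dual_dvd_def)
  then have "[a = s * c] (mod int l) \<and> [b = s * d + t * c] (mod int l)" if "l dvd m * k" for l
    using cong_dvd_modulus that int_dvd_int_iff by blast
  then show "dual_dvd m c d a b \<and> dual_dvd k c d a b"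
    unfolding dual_dvd_def using dvd_triv_left dvd_triv_right by blast
next
  have cop: "coprime (int m) (int k)" using assms by simp
  assume "dual_dvd m c d a b \<and> dual_dvd k c d a b"
  then obtain s t s' t' where
    m: "[a = s * c] (mod int m)" "[b = s * d + t * c] (mod int m)" and
    k: "[a = s' * c] (mod int k)" "[b = s' * d + t' * c] (mod int k)"
    by (auto simp: dual_dvd_def)
  obtain x where x: "[x = s] (mod int m)" "[x = s'] (mod int k)"
    using binary_chinese_remainder_int[OF cop] by blast
  obtain y where y: "[y = t] (mod int m)" "[y = t'] (mod int k)"
    using binary_chinese_remainder_int[OF cop] by blast
  have "[a = x * c] (mod int m * int k)"
  proof (rule coprime_cong_mult[OF _ _ cop])
    show "[a = x * c] (mod int m)"
      using m(1) x(1) by (meson cong_scalar_right cong_sym cong_trans)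
    show "[a = x * c] (mod int k)"
      using k(1) x(2) by (meson cong_scalar_right cong_sym cong_trans)
  qed
  moreover have "[b = x * d + y * c] (mod int m * int k)"
  proof (rule coprime_cong_mult[OF _ _ cop])
    show "[b = x * d + y * c] (mod int m)"
      using m(2) x(1) y(1) by (meson cong_add cong_scalar_right cong_sym cong_trans)
    show "[b = x * d + y * c] (mod int k)"
      using k(2) x(2) y(2) by (meson cong_add cong_scalar_right cong_sym cong_trans)
  qed
  ultimately show "dual_dvd (m * k) c d a b" by (auto simp: dual_dvd_def)
qed

lemma mem_PIdl_reduce_iff:
  assumes "1 < m" "1 < k" "coprime m k"
    and "u \<in> carrier (zdual (m * k))" "v \<in> carrier (zdual (m * k))"
  shows "u \<in> PIdl\<^bsub>zdual (m * k)\<^esub> v \<longleftrightarrow>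
    PIdl\<^bsub>zdual m\<^esub> (reduce (m * k) m u) \<subseteq> PIdl\<^bsub>zdual m\<^esub> (reduce (m * k) m v) \<and>
    PIdl\<^bsub>zdual k\<^esub> (reduce (m * k) k u) \<subseteq> PIdl\<^bsub>zdual k\<^esub> (reduce (m * k) k v)"
proof -
  have mk: "1 < m * k" by (rule less_1_mult[OF assms(1,2)])
  interpret mk: dual_residues "m * k" by unfold_locales fact
  interpret m: dual_residues m by unfold_locales fact
  interpret k: dual_residues k by unfold_locales fact
  obtain a b where u: "u = lin (m * k) a b" using mk.zdual_cases assms(4) by blast
  obtain c d where v: "v = lin (m * k) c d" using mk.zdual_cases assms(5) by blast
  have "reduce (m * k) m (lin (m * k) x y) = lin m x y"
    "reduce (m * k) k (lin (m * k) x y) = lin k x y" for x y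
    using assms(1,2) mk by (simp_all add: reduce_lin)
  then show ?thesis
    by (simp only: u v m.PIdl_subset_iff[OF m.lin_closed m.lin_closed]
        k.PIdl_subset_iff[OF k.lin_closed k.lin_closed]
        mk.lin_mem_PIdl_iff m.lin_mem_PIdl_iff k.lin_mem_PIdl_iff dual_dvd_mult_iff[OF assms(3)])
qed

text \<open>Surjectivity of the Chinese remainder map; it yields elements with prescribed
  components, so that no \<open>A_set\<close> is empty.\<close>

lemma ex_lin_reduce:
  assumes "1 < m" "1 < k" "coprime m k"
  shows "\<exists>e f. reduce (m * k) m (lin (m * k) e f) = lin m a b \<and>
    reduce (m * k) k (lin (m * k) e f) = lin k c d"
proof -
  have mk: "1 < m * k" by (rule less_1_mult[OF assms(1,2)])
  interpret m: dual_residues m by unfold_locales fact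
  interpret k: dual_residues k by unfold_locales fact
  have cop: "coprime (int m) (int k)" using assms by simp
  obtain e where "[e = a] (mod int m)" "[e = c] (mod int k)"
    using binary_chinese_remainder_int[OF cop] by blast
  moreover obtain f where "[f = b] (mod int m)" "[f = d] (mod int k)"
    using binary_chinese_remainder_int[OF cop] by blast
  ultimately show ?thesis
    using assms(1,2) mk by (intro exI[of _ e] exI[of _ f]) (simp add: reduce_lin m.lin_eq_iff k.lin_eq_iff)
qed

section \<open>The order of the labelled ideals\<close>

text \<open>
  The pair \<open>(a, b)\<close> stands for the generator \<open>a + b x\<close>.  For \<open>i = 3\<close> the subtraction \<open>i - 4\<close> truncates
  to \<open>0\<close>, so that the generator \<open>x\<close> is the case \<open>l = 0\<close> of \<open>x + l p\<close>.
\<close>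

definition I_gen :: "nat \<Rightarrow> nat \<Rightarrow> int \<times> int" where
  "I_gen p i =
     (if i = 1 then (0, 0) else if i = 2 then (0, int p) else if i = 4 then (int p, 0)
      else if i \<le> p + 3 then (int (i - 4) * int p, 1) else (1, 0))"

definition J_gen :: "nat \<Rightarrow> int \<times> int" where
  "J_gen j = (if j = 1 then (0, 0) else if j = 2 then (0, 1) else (1, 0))"

text \<open>Brings the whole ring into the same form as the other labelled ideals, with generator
  1.\<close>

lemma (in dual_residues) carrier_eq_PIdl: "carrier (zdual n) = PIdl\<^bsub>zdual n\<^esub> lin n 1 0"
  using Q.cgenideal_eq_genideal Q.genideal_one by (simp flip: one_zdual)

lemma I_ideal_eq:
  assumes "prime p"
  shows "I_ideal p i = PIdl\<^bsub>zdual (p^2)\<^esub> case_prod (lin (p^2)) (I_gen p i)"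
proof -
  interpret dual_residues "p^2"
    by unfold_locales (rule one_less_power[OF prime_gt_1_nat[OF assms] pos2])
  show ?thesis
    using prime_gt_0_nat[OF assms]
    by (auto simp: I_ideal_def I_gen_def Let_def zero_zdual carrier_eq_PIdl)
qed

lemma J_ideal_eq:
  assumes "prime q"
  shows "J_ideal q j = PIdl\<^bsub>zdual q\<^esub> case_prod (lin q) (J_gen j)"
proof -
  interpret dual_residues q
    by unfold_locales (use prime_gt_1_nat[OF assms] in simp)
  show ?thesis
    by (auto simp: J_ideal_def J_gen_def Let_def zero_zdual carrier_eq_PIdl)
qed

lemma J_ideal_subset_iff:
  assumes "prime q" "j1 \<in> {1..3}" "j2 \<in> {1..3}"
  shows "J_ideal q j1 \<subseteq> J_ideal q j2 \<longleftrightarrow> j1 \<le> j2"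
proof -
  interpret dual_residues q
    by unfold_locales (use prime_gt_1_nat[OF assms(1)] in simp)
  have q: "\<not> int q dvd 1" using prime_gt_1_nat[OF assms(1)] by simp
  have "J_ideal q j1 \<subseteq> J_ideal q j2 \<longleftrightarrow>
      dual_dvd q (fst (J_gen j2)) (snd (J_gen j2)) (fst (J_gen j1)) (snd (J_gen j1))"
    by (simp add: J_ideal_eq[OF assms(1)] case_prod_beta PIdl_subset_iff lin_mem_PIdl_iff)
  also have "\<dots> \<longleftrightarrow> j1 \<le> j2"
  proof -
    have "j1 = 1 \<or> j1 = 2 \<or> j1 = 3" "j2 = 1 \<or> j2 = 2 \<or> j2 = 3" using assms(2,3) by auto
    \<comment> \<open>Solvability of these congruences serves the inclusions; the failing ones would
      force q to divide 1.\<close>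
    moreover have "\<exists>s. [1 = s] (mod int q)" "\<exists>s. [0 = s] (mod int q)"
      using cong_refl by blast+
    ultimately show ?thesis
      using q by (auto simp: dual_dvd_def J_gen_def cong_0_iff cong_sym_eq[of 1 0] cong_sym_eq[of 0])
  qed
  finally show ?thesis .
qed

lemma dual_dvd_I_gen_iff:
  assumes "prime p" "i1 \<in> {1..p + 4}" "i2 \<in> {1..p + 4}"
  shows "dual_dvd (p^2) (fst (I_gen p i2)) (snd (I_gen p i2)) (fst (I_gen p i1)) (snd (I_gen p i1))
    \<longleftrightarrow> i1 = i2 \<or> i1 < i2 \<and> \<not> (3 \<le> i1 \<and> i2 \<le> p + 3)"
    (is "?D i1 i2 \<longleftrightarrow> ?R")
proof
  have p: "1 < int p" using prime_gt_1_nat[OF assms(1)] by simp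
  assume R: ?R
  \<comment> \<open>Equality, the zero ideal below everything, everything below the whole ring, and
    px below the middle layer.\<close>
  then consider "i1 = i2" | "i1 = 1" | "i2 = p + 4" | "i1 = 2" "i2 \<in> {3..p+3}"
    using assms(2,3) by fastforce
  then show "?D i1 i2"
  proof cases
    case 1
    then show ?thesis unfolding dual_dvd_def by (intro exI[of _ 1] exI[of _ 0]) simp
  next
    case 2
    then show ?thesis unfolding dual_dvd_def by (intro exI[of _ 0]) (simp add: I_gen_def)
  next
    case 3
    \<comment> \<open>The larger ideal is generated by 1, so the multiplier is the other generator
      itself.\<close>
    then show ?thesis
      unfolding dual_dvd_def using p
      by (intro exI[of _ "fst (I_gen p i1)"] exI[of _ "snd (I_gen p i1)"]) (simp add: I_gen_def)
  next
    case 4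
    then show ?thesis
    proof (cases "i2 = 4")
      case True
      \<comment> \<open>Multiplier x: px = x * p.\<close>
      with 4 show ?thesis unfolding dual_dvd_def
        by (intro exI[of _ 0] exI[of _ 1]) (simp add: I_gen_def)
    next
      case False
      \<comment> \<open>Multiplier p: p (x + l p) = px, because l p^2 vanishes.\<close>
      with 4 show ?thesis unfolding dual_dvd_def
        by (intro exI[of _ "int p"] exI[of _ 0])
          (auto simp: I_gen_def cong_def power2_eq_square)
    qed
  qed
next
  have p: "1 < int p" using prime_gt_1_nat[OF assms(1)] by simp
  have p1: "\<not> int p dvd 1" using p by simp
  have p2: "\<not> int p ^ 2 dvd int p" using p by (auto simp: power2_eq_square)
  have p3: "\<not> int p ^ 2 dvd 1" using p1 by (metis dvd_mult_left power2_eq_square)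
  have pdvd: "int p dvd a - b" if "[a = b] (mod int (p^2))" for a b
    using that by (auto simp: cong_iff_dvd_diff power2_eq_square dvd_mult_left)
  assume "?D i1 i2"
  then obtain s t where
    a: "[fst (I_gen p i1) = s * fst (I_gen p i2)] (mod int (p^2))" and
    b: "[snd (I_gen p i1) = s * snd (I_gen p i2) + t * fst (I_gen p i2)] (mod int (p^2))"
    by (auto simp: dual_dvd_def)
  \<comment> \<open>The same congruences weakened to modulus p, which removes every term with a
    factor p.\<close>
  note pa = pdvd[OF a] and pb = pdvd[OF b]
  have slope: "I_gen p i = (int (i - 4) * int p, 1)" if "i \<in> {3..p+3} - {4}" for i
    using that by (auto simp: I_gen_def)
  have gen_dvd: "int p dvd fst (I_gen p i)" if "i \<noteq> p + 4" "i \<in> {1..p+4}" for i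
    using that by (auto simp: I_gen_def)
  have g: "I_gen p (Suc 0) = (0, 0)" "I_gen p 2 = (0, int p)" "I_gen p 4 = (int p, 0)"
    "I_gen p (p + 4) = (1, 0)"
    using p by (simp_all add: I_gen_def)
  show ?R
  proof (rule ccontr)
    assume nR: "\<not> ?R"
    have "i = 1 \<or> i = 2 \<or> i = 4 \<or> i \<in> {3..p+3} - {4} \<or> i = p + 4" if "i \<in> {1..p + 4}" for i
      using that by auto
    note range = this[OF assms(2)] this[OF assms(3)]
    have "i1 \<noteq> i2" using nR by blast
    \<comment> \<open>Cases 1 and 5 contradict \<open>nR\<close> directly; so does i1 = 1 in case 4.
      The others are genuine failures of divisibility.\<close>
    with range consider "i2 = p + 4" | "i2 \<noteq> p + 4" "i1 = p + 4"
      | "i2 = 1" "i1 = 2 \<or> i1 = 4 \<or> i1 \<in> {3..p+3} - {4}"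
      | "i2 = 2" "i1 = 1 \<or> i1 = 4 \<or> i1 \<in> {3..p+3} - {4}"
      | "i2 = 4 \<or> i2 \<in> {3..p+3} - {4}" "i1 = 1 \<or> i1 = 2"
      | "i2 = 4" "i1 \<in> {3..p+3} - {4}" | "i2 \<in> {3..p+3} - {4}" "i1 = 4"
      | "i2 \<in> {3..p+3} - {4}" "i1 \<in> {3..p+3} - {4}"
      by blast
    then show False
    proof cases
      case 1
      then show ?thesis using nR assms(2) by auto
    next
      case 2
      then have "int p dvd s * fst (I_gen p i2)" using gen_dvd assms(3) by (simp add: dvd_mult)
      then have "int p dvd fst (I_gen p i1)" using pa by (metis dvd_diff_commute dvd_diff_right_iff)
      then show ?thesis using 2 p1 by (simp add: g)
    next
      case 3
      then have "int p ^ 2 dvd fst (I_gen p i1)" "int p ^ 2 dvd snd (I_gen p i1)"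
        using a b by (simp_all add: g cong_0_iff)
      with 3(2) show ?thesis
        using p2 p3 slope by (elim disjE) (simp_all add: g)
    next
      case 4
      \<comment> \<open>Multiples of px have constant term 0 and x-coefficient divisible by p. The
        first excludes p, the second x + l p.\<close>
      then have "int p ^ 2 dvd fst (I_gen p i1)"
        using a by (simp add: g cong_0_iff)
      moreover have "int p dvd snd (I_gen p i1)"
        using pb 4(1) by (simp add: g dvd_diff_left_iff)
      moreover have "i1 \<noteq> 1" using 4(1) nR by auto
      ultimately show ?thesis
        using 4(2) p1 p2 slope by (elim disjE) (simp_all add: g)
    next
      case 5
      then show ?thesis using nR by auto
    next
      case 6
      \<comment> \<open>A multiple of p has x-coefficient divisible by p, whereas x + l p has
        x-coefficient 1.\<close>
      then show ?thesis using pb p1 by (simp add: slope) (simp add: g dvd_diff_left_iff)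
    next
      case 7
      \<comment> \<open>If p were (s + t x)(x + l p), the x-coefficient would give p | s; then the
        constant term s l p is 0 modulo p^2, unlike p.\<close>
      then have "int p dvd s" using pb by (simp add: slope g dvd_diff_left_iff)
      then obtain r where "s = int p * r" ..
      then have "int p ^ 2 dvd s * (int (i2 - 4) * int p)" by (simp add: power2_eq_square)
      moreover have "int p ^ 2 dvd int p - s * (int (i2 - 4) * int p)"
        using a 7 by (simp add: slope g cong_iff_dvd_diff)
      ultimately show ?thesis using p2 dvd_diff_left_iff by blast
    next
      case 8
      \<comment> \<open>The x-coefficient forces s = 1 modulo p; cancelling p in the constant term
        gives l' = s l modulo p. Hence l' = l modulo p, and both lie in 0, ..., p - 1.\<close>
      define l l' where "l = int (i2 - 4)" and "l' = int (i1 - 4)"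
      have range: "0 \<le> l" "l < p" "0 \<le> l'" "l' < p" using 8 p by (auto simp: l_def l'_def)
      have "int p * int p dvd (l' - s * l) * int p"
        using a 8 by (simp add: slope cong_iff_dvd_diff power2_eq_square l_def l'_def algebra_simps)
      then have "int p dvd l' - s * l" using p by simp
      moreover have "int p dvd 1 - s"
      proof -
        have "int p dvd (1 - s) - t * l * int p"
          using pb 8 by (simp add: slope l_def algebra_simps)
        then show ?thesis by (simp add: dvd_diff_left_iff)
      qed
      then have "int p dvd (1 - s) * l" by simp
      ultimately have "int p dvd (l' - s * l) - (1 - s) * l" by (rule dvd_diff)
      then have "int p dvd l' - l" by (simp add: algebra_simps)
      then have "[l' = l] (mod int p)" by (simp add: cong_iff_dvd_diff)
      then have "l' = l" using range by (simp add: cong_def)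
      \<comment> \<open>Truncation causes no collision: with label 4 excluded, the value 0 comes
        from label 3 alone.\<close>
      then show ?thesis using 8 nR by (auto simp: l_def l'_def)
    qed
  qed
qed

lemma I_ideal_subset_iff:
  assumes "prime p" "i1 \<in> {1..p + 4}" "i2 \<in> {1..p + 4}"
  shows "I_ideal p i1 \<subseteq> I_ideal p i2 \<longleftrightarrow> i1 = i2 \<or> i1 < i2 \<and> \<not> (3 \<le> i1 \<and> i2 \<le> p + 3)"
proof -
  interpret dual_residues "p^2"
    by unfold_locales (rule one_less_power[OF prime_gt_1_nat[OF assms(1)] pos2])
  show ?thesis
    by (simp add: I_ideal_eq[OF assms(1)] case_prod_beta PIdl_subset_iff lin_mem_PIdl_iff
        dual_dvd_I_gen_iff[OF assms] del: of_nat_power)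
qed

section \<open>The cozero-divisor graph of \<open>\<int>\<^sub>n[x]/(x\<^sup>2)\<close> for \<open>n = p\<^sup>2 q\<close>\<close>

locale two_primes =
  fixes p q :: nat
  assumes prime_p: "prime p" and prime_q: "prime q" and p_neq_q: "p \<noteq> q"
begin

lemma gt_1: "1 < p^2" "1 < q"
  by (rule one_less_power[OF prime_gt_1_nat[OF prime_p] pos2]) (rule prime_gt_1_nat[OF prime_q])

lemma coprime_sq: "coprime (p^2) q"
  using primes_coprime[OF prime_p prime_q p_neq_q] by simp

sublocale N: dual_residues "p^2 * q"
  by unfold_locales (rule less_1_mult[OF gt_1])

sublocale p: dual_residues "p^2"
  by unfold_locales (fact gt_1)

sublocale q: dual_residues q
  by unfold_locales (fact gt_1)

section \<open>The sets \<open>A_set\<close> and divisibility between their elements\<close>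

lemma A_set_nonempty: "A_set p q i j \<noteq> {}"
proof -
  obtain e f where
    "reduce (p^2 * q) (p^2) (lin (p^2 * q) e f) = case_prod (lin (p^2)) (I_gen p i)"
    "reduce (p^2 * q) q (lin (p^2 * q) e f) = case_prod (lin q) (J_gen j)"
    using ex_lin_reduce[OF gt_1 coprime_sq] by (metis case_prod_beta)
  then have "lin (p^2 * q) e f \<in> A_set p q i j"
    by (simp add: A_set_def I_ideal_eq[OF prime_p] J_ideal_eq[OF prime_q])
  then show ?thesis by blast
qed

lemma A_set_mem_PIdl_iff:
  assumes "u \<in> A_set p q i1 j1" "v \<in> A_set p q i2 j2"
  shows "u \<in> PIdl\<^bsub>zdual (p^2 * q)\<^esub> v \<longleftrightarrow>
    I_ideal p i1 \<subseteq> I_ideal p i2 \<and> J_ideal q j1 \<subseteq> J_ideal q j2"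
  using assms mem_PIdl_reduce_iff[OF gt_1 coprime_sq, of u v] by (simp add: A_set_def)

text \<open>Locates zero and one, whose generator pairs coincide in the two factors.\<close>

lemma lin_mem_A_set:
  assumes "I_gen p i = (a, b)" "J_gen j = (a, b)"
  shows "lin (p^2 * q) a b \<in> A_set p q i j"
  using assms gt_1 N.n_gt_1
  by (simp add: A_set_def I_ideal_eq[OF prime_p] J_ideal_eq[OF prime_q] reduce_lin)

text \<open>Zero lies in the set labelled (1, 1) and one in the set labelled (p + 4, 3). If
  \<open>u\<close> were zero or a unit, the inclusions of ideals would force one of these excluded
  labels.\<close>

lemma A_set_vertices:
  assumes "(i, j) \<in> A_indices p"
  shows "A_set p q i j \<subseteq> cozero_verts (zdual (p^2 * q))"
proof
  fix u assume u: "u \<in> A_set p q i j"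
  have ij: "i \<in> {1..p + 4}" "j \<in> {1..3}" "(i, j) \<noteq> (1, 1)" "(i, j) \<noteq> (p + 4, 3)"
    using assms by (auto simp: A_indices_def)
  have carr: "u \<in> carrier (zdual (p^2 * q))" using u by (simp add: A_set_def)
  have zero: "\<zero>\<^bsub>zdual (p^2 * q)\<^esub> \<in> A_set p q 1 1"
    unfolding N.zero_zdual by (rule lin_mem_A_set) (simp_all add: I_gen_def J_gen_def)
  have one: "\<one>\<^bsub>zdual (p^2 * q)\<^esub> \<in> A_set p q (p + 4) 3"
    unfolding N.one_zdual by (rule lin_mem_A_set) (use prime_gt_0_nat[OF prime_p] in \<open>simp_all add: I_gen_def J_gen_def\<close>)
  have "u \<noteq> \<zero>\<^bsub>zdual (p^2 * q)\<^esub>"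
  proof
    assume "u = \<zero>\<^bsub>zdual (p^2 * q)\<^esub>"
    then have "I_ideal p i \<subseteq> I_ideal p 1 \<and> J_ideal q j \<subseteq> J_ideal q 1"
      using A_set_mem_PIdl_iff[OF u zero] N.Q.cgenideal_self[OF carr] by simp
    then show False
      using ij by (auto simp: I_ideal_subset_iff[OF prime_p] J_ideal_subset_iff[OF prime_q])
  qed
  moreover have "u \<notin> Units (zdual (p^2 * q))"
  proof
    assume "u \<in> Units (zdual (p^2 * q))"
    then have "\<one>\<^bsub>zdual (p^2 * q)\<^esub> = inv\<^bsub>zdual (p^2 * q)\<^esub> u \<otimes>\<^bsub>zdual (p^2 * q)\<^esub> u"
      "inv\<^bsub>zdual (p^2 * q)\<^esub> u \<in> carrier (zdual (p^2 * q))"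
      by (simp_all add: N.Q.Units_l_inv N.Q.Units_inv_closed)
    then have "\<one>\<^bsub>zdual (p^2 * q)\<^esub> \<in> PIdl\<^bsub>zdual (p^2 * q)\<^esub> u"
      unfolding cgenideal_def by blast
    then have "I_ideal p (p + 4) \<subseteq> I_ideal p i \<and> J_ideal q 3 \<subseteq> J_ideal q j"
      using A_set_mem_PIdl_iff[OF one u] by simp
    then show False
      using ij by (auto simp: I_ideal_subset_iff[OF prime_p] J_ideal_subset_iff[OF prime_q])
  qed
  ultimately show "u \<in> cozero_verts (zdual (p^2 * q))"
    using carr by (simp add: cozero_verts_def)
qed

lemma A_set_adj_iff:
  assumes "(i1, j1) \<in> A_indices p" "(i2, j2) \<in> A_indices p"
    and "u \<in> A_set p q i1 j1" "v \<in> A_set p q i2 j2"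
  shows "cozero_adj (zdual (p^2 * q)) u v \<longleftrightarrow>
    (i1 \<noteq> i2 \<and> i1 \<in> {3..p + 3} \<and> i2 \<in> {3..p + 3}) \<or>
    (i1 < i2 \<and> j1 > j2) \<or> (i2 < i1 \<and> j2 > j1)"
proof -
  have ij: "i1 \<in> {1..p + 4}" "j1 \<in> {1..3}" "i2 \<in> {1..p + 4}" "j2 \<in> {1..3}"
    using assms(1,2) by (auto simp: A_indices_def)
  have carr: "v \<in> carrier (zdual (p^2 * q))" using assms(4) by (simp add: A_set_def)
  \<comment> \<open>Distinctness is automatic: \<open>v\<close> lies in its own principal
    ideal.\<close>
  have "cozero_adj (zdual (p^2 * q)) u v \<longleftrightarrow>
      u \<notin> PIdl\<^bsub>zdual (p^2 * q)\<^esub> v \<and> v \<notin> PIdl\<^bsub>zdual (p^2 * q)\<^esub> u"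
    using A_set_vertices[OF assms(1)] A_set_vertices[OF assms(2)] assms(3,4)
      N.Q.cgenideal_self[OF carr] by (auto simp: cozero_adj_def)
  also have "\<dots> \<longleftrightarrow> (i1 \<noteq> i2 \<and> i1 \<in> {3..p + 3} \<and> i2 \<in> {3..p + 3}) \<or>
      (i1 < i2 \<and> j1 > j2) \<or> (i2 < i1 \<and> j2 > j1)"
    \<comment> \<open>Two middle ideals with different labels block both inclusions whatever the
      J-labels are. Otherwise the I-labels are comparable, and only a strictly opposite order of the
      J-labels blocks both.\<close>
    unfolding A_set_mem_PIdl_iff[OF assms(3,4)] A_set_mem_PIdl_iff[OF assms(4,3)]
      I_ideal_subset_iff[OF prime_p ij(1,3)] I_ideal_subset_iff[OF prime_p ij(3,1)]
      J_ideal_subset_iff[OF prime_q ij(2,4)] J_ideal_subset_iff[OF prime_q ij(4,2)]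
    using ij by (simp, linarith)
  finally show ?thesis .
qed

end

theorem theorem3p13:
  fixes p q :: nat
  assumes "prime p" and "prime q" and "p \<noteq> q"
  shows "(\<forall>i1 j1 i2 j2. (i1, j1) \<in> A_indices p \<longrightarrow> (i2, j2) \<in> A_indices p \<longrightarrow>
            ((\<forall>u \<in> A_set p q i1 j1. \<forall>v \<in> A_set p q i2 j2. cozero_adj (zdual (p^2 * q)) u v)
             \<longleftrightarrow>
             (i1 \<noteq> i2 \<and> i1 \<in> {3..p + 3} \<and> i2 \<in> {3..p + 3}) \<or>
             (i1 < i2 \<and> j1 > j2) \<or>
             (i2 < i1 \<and> j2 > j1)))
       \<and> (\<forall>i j. (i, j) \<in> A_indices p \<longrightarrow>
            (\<forall>u \<in> A_set p q i j. \<forall>v \<in> A_set p q i j. \<not> cozero_adj (zdual (p^2 * q)) u v))"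
proof -
  interpret two_primes p q by unfold_locales fact+
  show ?thesis
  proof (intro conjI allI impI)
    fix i1 j1 i2 j2
    assume *: "(i1, j1) \<in> A_indices p" "(i2, j2) \<in> A_indices p"
    \<comment> \<open>Adjacency depends on the labels alone, so one pair of elements decides the
      universal statement and rules out vacuous truth.\<close>
    obtain u v where "u \<in> A_set p q i1 j1" "v \<in> A_set p q i2 j2"
      using A_set_nonempty by blast
    then show "(\<forall>u \<in> A_set p q i1 j1. \<forall>v \<in> A_set p q i2 j2. cozero_adj (zdual (p^2 * q)) u v)
        \<longleftrightarrow> (i1 \<noteq> i2 \<and> i1 \<in> {3..p + 3} \<and> i2 \<in> {3..p + 3}) \<or>
          (i1 < i2 \<and> j1 > j2) \<or> (i2 < i1 \<and> j2 > j1)"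
      using A_set_adj_iff[OF *] by blast
  next
    fix i j
    assume *: "(i, j) \<in> A_indices p"
    \<comment> \<open>With equal label pairs, every alternative of the criterion fails.\<close>
    show "\<forall>u \<in> A_set p q i j. \<forall>v \<in> A_set p q i j. \<not> cozero_adj (zdual (p^2 * q)) u v"
      using A_set_adj_iff[OF * *] by blast
  qed
qed

end
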